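(* Let $a,b,c,t_0\in\mathbb{R}$ and $h\in L^1_{\mathrm{loc}}(\mathbb{R})$. Let $\tilde u,\tilde v$ be the solutions of $$\tilde u'(t)+a\,\tilde u(-t)+b\,\tilde u(t)=0,\ \tilde u(0)=1,\qquad \tilde v'(t)-a\,\tilde v(-t)+b\,\tilde v(t)=0,\ \tilde v(0)=1\qquad (t\in\mathbb{R}),$$ and suppose $\tilde u(t_0)\ne 0$. Then the unique solution $u\in W^{1,1}_{\mathrm{loc}}(\mathbb{R})$ of the problem $$u'(t)+a\,u(-t)+b\,u(t)=h(t)\ \text{ for a.e. } t\in\mathbb{R},\qquad u(t_0)=c,$$ is given by $$u(t)=\int_{-\infty}^{\infty}G(t,s)h(s)\,ds+\frac{c-\bar u(t_0)}{\tilde u(t_0)}\,\tilde u(t),\qquad t\in\mathbb{R},$$ where $$G(t,s):=\tfrac12\Big(\big[\tilde u(-s)\tilde v(t)+\tilde v(-s)\tilde u(t)\big]\chi_0^t(s)+\big[\tilde u(-s)\tilde v(t)-\tilde v(-s)\tilde u(t)\big]\chi_{-t}^0(s)\Big),\qquad t,s\in\mathbb{R}.$$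
   Context: For $t_1,t_2\in\mathbb{R}$ the oriented characteristic function is $\chi_{t_1}^{t_2}(t)=1$ if $t_1\le t\le t_2$, $\chi_{t_1}^{t_2}(t)=-1$ if $t_2\le t<t_1$, and $0$ otherwise (so $\int_{t_1}^{t_2}f=\int_{-\infty}^{\infty}\chi_{t_1}^{t_2}f$). For $f:\mathbb{R}\to\mathbb{R}$, $f_e(x)=\frac{f(x)+f(-x)}2$ and $f_o(x)=\frac{f(x)-f(-x)}2$ are the even and odd parts. The function $\bar u$ is defined by $$\bar u(t)=\tilde u(t)\int_0^t\varphi(s)\,ds+\tilde v(t)\int_0^t\psi(s)\,ds,\qquad \varphi=\frac{h_o\tilde v_e-h_e\tilde v_o}{\tilde u_e\tilde v_e-\tilde u_o\tilde v_o},\quad \psi=\frac{h_e\tilde u_e-h_o\tilde u_o}{\tilde u_e\tilde v_e-\tilde u_o\tilde v_o},$$ where the denominator is identically $1$. With $\omega:=\sqrt{|a^2-b^2|}$, explicitly: $\tilde u(t)=\cos\omega t-\frac{a+b}{\omega}\sin\omega t$ if $a^2>b^2$; $\tilde u(t)=\cosh\omega t-\frac{a+b}{\omega}\sinh\omega t$ if $a^2<b^2$; $\tilde u(t)=1-2at$ if $a=b$; $\tilde u(t)=1$ if $a=-b$; and $\tilde v$ is obtained from $\tilde u$ by replacing $a$ with $-a$. *)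

theory Defs
  imports "HOL-Analysis.Analysis"
begin

(* Integrals and "almost everywhere" refer to the completed measure lebesgue, not to lborel:
   members of L^1_loc are only Lebesgue measurable, and the Bochner integral of a
   non-Borel function over lborel is 0 by convention. *)

definition L1_loc :: "(real \<Rightarrow> real) set" where
  "L1_loc = {f. \<forall>K. compact K \<longrightarrow> f absolutely_integrable_on K}"

definition test_function :: "(real \<Rightarrow> real) \<Rightarrow> bool" where
  "test_function \<phi> \<longleftrightarrow>
     (\<forall>n. (deriv ^^ n) \<phi> differentiable_on UNIV) \<and> compact (closure {x. \<phi> x \<noteq> 0})"

definition weak_derivative :: "(real \<Rightarrow> real) \<Rightarrow> (real \<Rightarrow> real) \<Rightarrow> bool" where
  "weak_derivative f g \<longleftrightarrow> f \<in> L1_loc \<and> g \<in> L1_loc \<and>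
     (\<forall>\<phi>. test_function \<phi> \<longrightarrow>
        (\<integral>x. f x * deriv \<phi> x \<partial>lebesgue) = - (\<integral>x. g x * \<phi> x \<partial>lebesgue))"

(* Elements of the Sobolev space are identified with their continuous representatives,
   which is what gives point values such as u(t0) a meaning. *)

definition W11_loc :: "(real \<Rightarrow> real) set" where
  "W11_loc = {f. continuous_on UNIV f \<and> (\<exists>g. weak_derivative f g)}"

(* The derivative u' of u in W11_loc is determined only up to null sets. *)

definition reflection_solution ::
    "real \<Rightarrow> real \<Rightarrow> (real \<Rightarrow> real) \<Rightarrow> real \<Rightarrow> real \<Rightarrow> (real \<Rightarrow> real) \<Rightarrow> bool" where
  "reflection_solution a b h t\<^sub>0 c u \<longleftrightarrow>
     u \<in> W11_loc \<and>
     (\<exists>u'. weak_derivative u u' \<and> (AE t in lebesgue. u' t + a * u (- t) + b * u t = h t)) \<and>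
     u t\<^sub>0 = c"

definition oriented_char :: "real \<Rightarrow> real \<Rightarrow> real \<Rightarrow> real" where
  "oriented_char t1 t2 t =
     (if t1 \<le> t \<and> t \<le> t2 then 1 else if t2 \<le> t \<and> t < t1 then - 1 else 0)"

definition even_part :: "(real \<Rightarrow> real) \<Rightarrow> real \<Rightarrow> real" where
  "even_part f x = (f x + f (- x)) / 2"

definition odd_part :: "(real \<Rightarrow> real) \<Rightarrow> real \<Rightarrow> real" where
  "odd_part f x = (f x - f (- x)) / 2"

(* Below, v and w stand for the two fundamental solutions
   u-tilde and v-tilde, in this order. *)

definition u_bar :: "(real \<Rightarrow> real) \<Rightarrow> (real \<Rightarrow> real) \<Rightarrow> (real \<Rightarrow> real) \<Rightarrow> real \<Rightarrow> real" where
  "u_bar v w h t =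
     (let D = (\<lambda>s. even_part v s * even_part w s - odd_part v s * odd_part w s);
          \<phi> = (\<lambda>s. (odd_part h s * even_part w s - even_part h s * odd_part w s) / D s);
          \<psi> = (\<lambda>s. (even_part h s * even_part v s - odd_part h s * odd_part v s) / D s)
      in v t * interval_lebesgue_integral lebesgue 0 (ereal t) \<phi>
         + w t * interval_lebesgue_integral lebesgue 0 (ereal t) \<psi>)"

definition Green :: "(real \<Rightarrow> real) \<Rightarrow> (real \<Rightarrow> real) \<Rightarrow> real \<Rightarrow> real \<Rightarrow> real" where
  "Green v w t s =
     1 / 2 * ((v (- s) * w t + w (- s) * v t) * oriented_char 0 t s
            + (v (- s) * w t - w (- s) * v t) * oriented_char (- t) 0 s)"

end

theory Submission
  imports Defs
begin

text \<open>
  The substitution \<open>t \<mapsto> - t\<close> makes the equation nonlocal, but on the even and odd parts it acts by a sign.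
  For a solution \<open>z\<close> of \<open>z' + a z(- t) + b z = 0\<close> the pair of its even and odd part therefore solves
  an ordinary linear system, \<open>z\<^sub>e' = (a - b) z\<^sub>o\<close> and \<open>z\<^sub>o' = - (a + b) z\<^sub>e\<close>.  This system is
  trace free, so the Wronskian of two solutions is constant.  If \<open>v\<close> solves the equation with \<open>- a\<close>,
  then \<open>(v\<^sub>o, v\<^sub>e)\<close> solves the same system, so \<open>z\<^sub>e v\<^sub>e - z\<^sub>o v\<^sub>o\<close> is constant as well.

  Both halves of the theorem rest on these two constants.  With \<open>z = u\<close> and the initial values the second one says
  \<open>u\<^sub>e v\<^sub>e - u\<^sub>o v\<^sub>o = 1\<close>.  For a general \<open>z\<close> the two relations are linear equations for
  \<open>z\<^sub>e\<close> and \<open>z\<^sub>o\<close> with this determinant, and solving them gives \<open>z = z(0) u\<close>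
  (\<open>reflection_ode_unique\<close>): the homogeneous problem has a one-dimensional solution space, and \<open>u(t\<^sub>0) \<noteq> 0\<close>
  fixes the multiple.  For the inhomogeneous equation put \<open>B = u \<Phi> + v \<Psi>\<close> with \<open>\<Phi>\<close> even and
  \<open>\<Psi>\<close> odd.  Reflection then sends \<open>B\<close> to \<open>u(- t) \<Phi> - v(- t) \<Psi>\<close>, so everything cancels
  except \<open>u \<Phi>' + v \<Psi>'\<close>, which has to equal \<open>h\<close>.  As \<open>\<Phi>'\<close> is odd and \<open>\<Psi>'\<close> is even, comparing
  parities determines both, again with determinant \<open>1\<close> (\<open>variation_of_parameters\<close>).  Folding the
  reflected half of the two integrals back turns \<open>B\<close> into the integral against Green's function
  (\<open>Green_integral\<close>).

  What remains is to connect weak derivatives with primitives.  Fubini's theorem gives integration by parts for a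
  primitive of a locally integrable function, which shows that \<open>B\<close> has a weak derivative.  Conversely,
  by the lemma of du Bois-Reymond a continuous function with weak derivative \<open>g\<close> is a primitive of \<open>g\<close>.
  A continuous weak solution of the homogeneous equation is therefore continuously differentiable and satisfies the
  equation everywhere.
\<close>

section \<open>Locally integrable functions and their primitives\<close>

lemma L1_locI:
  assumes "\<And>x y. f absolutely_integrable_on {x..y}"
  shows "f \<in> L1_loc"
  unfolding L1_loc_def
proof (intro CollectI allI impI)
  fix K :: "real set"
  assume "compact K"
  then obtain R where "\<And>x. x \<in> K \<Longrightarrow> norm x \<le> R"
    using compact_imp_bounded bounded_iff by metis
  then have "K \<subseteq> {-R..R}"
    by (auto simp: abs_le_iff minus_le_iff)
  moreover have "K \<in> sets lebesgue"
    using \<open>compact K\<close> by (simp add: lmeasurable_compact fmeasurableD)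
  ultimately show "f absolutely_integrable_on K"
    by (intro set_integrable_subset[OF assms])
qed

lemma L1_loc_Icc: "f \<in> L1_loc \<Longrightarrow> f absolutely_integrable_on {x..y}"
  by (simp add: L1_loc_def)

lemma L1_loc_continuous: "continuous_on UNIV f \<Longrightarrow> f \<in> L1_loc"
  by (rule L1_locI) (auto intro: absolutely_integrable_continuous_real continuous_on_subset)

lemma L1_loc_add: "f \<in> L1_loc \<Longrightarrow> g \<in> L1_loc \<Longrightarrow> (\<lambda>x. f x + g x) \<in> L1_loc"
  by (rule L1_locI, rule set_integral_add) (simp_all add: L1_loc_Icc)

lemma L1_loc_diff: "f \<in> L1_loc \<Longrightarrow> g \<in> L1_loc \<Longrightarrow> (\<lambda>x. f x - g x) \<in> L1_loc"
  by (rule L1_locI, rule set_integral_diff) (simp_all add: L1_loc_Icc)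

lemma L1_loc_mult:
  assumes "continuous_on UNIV g" and "f \<in> L1_loc"
  shows "(\<lambda>x. g x * f x) \<in> L1_loc"
proof (rule L1_locI)
  fix x y :: real
  have g: "continuous_on {x..y} g"
    using assms(1) by (rule continuous_on_subset) simp
  show "(\<lambda>x. g x * f x) absolutely_integrable_on {x..y}"
  proof (rule absolutely_integrable_bounded_measurable_product_real)
    show "g \<in> borel_measurable (lebesgue_on {x..y})"
      by (rule continuous_imp_measurable_on_sets_lebesgue[OF g]) simp
    show "bounded (g ` {x..y})"
      by (intro compact_imp_bounded compact_continuous_image g compact_Icc)
  qed (simp_all add: L1_loc_Icc assms(2))
qed

lemma L1_loc_reflect:
  assumes "f \<in> L1_loc"
  shows "(\<lambda>x. f (- x)) \<in> L1_loc"
proof (rule L1_locI)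
  fix x y :: real
  have "f absolutely_integrable_on {- y..- x}"
    by (rule L1_loc_Icc[OF assms])
  then show "(\<lambda>x. f (- x)) absolutely_integrable_on {x..y}"
    using absolutely_integrable_reflect_real[where f=f and a="- y" and b="- x"] by simp
qed

lemma L1_loc_integrable_on: "f \<in> L1_loc \<Longrightarrow> f integrable_on {x..y}"
  by (simp add: L1_loc_Icc set_lebesgue_integral_eq_integral(1))

lemma integral_compact_support:
  fixes k :: "real \<Rightarrow> real"
  assumes "k \<in> L1_loc" and "\<And>x. x \<notin> {-R..R} \<Longrightarrow> k x = 0"
  shows "integrable lebesgue k" and "(\<integral>x. k x \<partial>lebesgue) = integral {-R..R} k"
proof -
  have k: "(\<lambda>x. indicator {-R..R} x *\<^sub>R k x) = k"
    using assms(2) by (force simp: indicator_def)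
  have *: "k absolutely_integrable_on {-R..R}"
    by (rule L1_loc_Icc[OF assms(1)])
  show "integrable lebesgue k"
    using * unfolding set_integrable_def k .
  show "(\<integral>x. k x \<partial>lebesgue) = integral {-R..R} k"
    using set_lebesgue_integral_eq_integral(2)[OF *]
    unfolding set_lebesgue_integral_def k .
qed

abbreviation primitive :: "(real \<Rightarrow> real) \<Rightarrow> real \<Rightarrow> real" where
  "primitive f t \<equiv> interval_lebesgue_integral lebesgue 0 (ereal t) f"

text \<open>
  The oriented characteristic function includes some of its end points, the interval integral none; these points
  have measure zero.
\<close>

lemma interval_integral_oriented_char:
  "(\<integral>s. oriented_char p q s * f s \<partial>lebesgue) = interval_lebesgue_integral lebesgue (ereal p) (ereal q) f"
proof (cases "p \<le> q")
  case True
  have "(\<integral>s. oriented_char p q s * f s \<partial>lebesgue)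
      = (\<integral>s. indicator (einterval (ereal p) (ereal q)) s *\<^sub>R f s \<partial>lebesgue)"
    by (rule integral_discrete_difference[where X="{p, q}"])
      (use True in \<open>auto simp: oriented_char_def indicator_def einterval_iff\<close>)
  with True show ?thesis
    by (simp add: interval_lebesgue_integral_def set_lebesgue_integral_def)
next
  case False
  have "(\<integral>s. oriented_char p q s * f s \<partial>lebesgue)
      = (\<integral>s. - (indicator (einterval (ereal q) (ereal p)) s *\<^sub>R f s) \<partial>lebesgue)"
    by (rule integral_discrete_difference[where X="{p, q}"])
      (use False in \<open>auto simp: oriented_char_def indicator_def einterval_iff\<close>)
  with False show ?thesis
    by (simp add: interval_lebesgue_integral_def set_lebesgue_integral_def)
qed

lemma interval_integral_eq_integral_L1_loc:
  assumes "f \<in> L1_loc"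
  shows "interval_lebesgue_integral lebesgue (ereal p) (ereal q) f
    = (if p \<le> q then integral {p..q} f else - integral {q..p} f)"
proof -
  have *: "(LINT x:einterval (ereal p) (ereal q)|lebesgue. f x) = integral {p..q} f" for p q
  proof -
    have "f absolutely_integrable_on {p<..<q}"
      using L1_loc_Icc[OF assms, of p q] by (simp only: absolutely_integrable_on_Icc_iff_Ioo)
    then show ?thesis
      by (simp add: einterval_eq_Icc set_lebesgue_integral_eq_integral(2) integral_open_interval_real)
  qed
  show ?thesis
    by (simp add: interval_lebesgue_integral_def * del: einterval_eq_Icc)
qed

lemma primitive_eq_integral:
  assumes "f \<in> L1_loc"
  shows "primitive f t = (if 0 \<le> t then integral {0..t} f else - integral {t..0} f)"
  using interval_integral_eq_integral_L1_loc[OF assms, of 0 t] by (simp add: zero_ereal_def)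

lemma primitive_diff:
  assumes "f \<in> L1_loc" and "x \<le> y"
  shows "primitive f y - primitive f x = integral {x..y} f"
proof -
  note combine = Henstock_Kurzweil_Integration.integral_combine
      [OF _ _ L1_loc_integrable_on[OF assms(1)]]
  consider "0 \<le> x" | "x < 0" "0 \<le> y" | "y < 0"
    by linarith
  then show ?thesis
  proof cases
    case 1
    with combine[of 0 x y] assms show ?thesis
      by (simp add: primitive_eq_integral)
  next
    case 2
    with combine[of x 0 y] assms show ?thesis
      by (simp add: primitive_eq_integral)
  next
    case 3
    with combine[of x y 0] assms show ?thesis
      by (auto simp: primitive_eq_integral)
  qed
qed

lemma primitive_0 [simp]: "primitive f 0 = 0" "interval_lebesgue_integral lebesgue 0 0 f = 0"
  by (simp_all add: interval_lebesgue_integral_def set_lebesgue_integral_def einterval_same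
      flip: zero_ereal_def)

lemma primitive_add:
  assumes "f \<in> L1_loc" and "g \<in> L1_loc"
  shows "primitive (\<lambda>s. f s + g s) t = primitive f t + primitive g t"
  using assms
  by (simp add: primitive_eq_integral L1_loc_add Henstock_Kurzweil_Integration.integral_add
      L1_loc_integrable_on)

lemma primitive_reflect:
  assumes "f \<in> L1_loc"
  shows "primitive (\<lambda>s. f (- s)) t = - primitive f (- t)"
  using Henstock_Kurzweil_Integration.integral_reflect_real[where a=0 and b="-t" and f=f]
    Henstock_Kurzweil_Integration.integral_reflect_real[where a="-t" and b=0 and f=f] assms L1_loc_reflect[OF assms]
  by (auto simp: primitive_eq_integral)

lemma primitive_cong_AE:
  assumes f: "f \<in> L1_loc" and g: "g \<in> L1_loc" and "AE t in lebesgue. f t = g t"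
  shows "primitive f t = primitive g t"
proof -
  have "integral {x..y} f = integral {x..y} g" for x y
  proof -
    have "(LINT t:{x..y}|lebesgue. f t) = (LINT t:{x..y}|lebesgue. g t)"
      unfolding set_lebesgue_integral_def
    proof (rule integral_cong_AE)
      show "(\<lambda>t. indicator {x..y} t *\<^sub>R f t) \<in> borel_measurable lebesgue"
        "(\<lambda>t. indicator {x..y} t *\<^sub>R g t) \<in> borel_measurable lebesgue"
        using L1_loc_Icc[OF f] L1_loc_Icc[OF g]
        by (auto simp: set_integrable_def dest: borel_measurable_integrable)
    qed (use assms(3) in auto)
    then show ?thesis
      by (simp add: set_lebesgue_integral_eq_integral(2) L1_loc_Icc f g)
  qed
  then show ?thesis
    by (simp add: primitive_eq_integral f g)
qed

lemma primitive_cmult: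
  assumes "f \<in> L1_loc"
  shows "primitive (\<lambda>s. k * f s) t = k * primitive f t"
  using L1_loc_mult[OF continuous_on_const assms, of k] assms
  by (simp add: primitive_eq_integral)

lemma primitive_even:
  assumes "f \<in> L1_loc" and "\<And>s. f (- s) = f s"
  shows "primitive f (- t) = - primitive f t"
  using primitive_reflect[OF assms(1), of t] assms(2) by simp

lemma primitive_odd:
  assumes "f \<in> L1_loc" and "\<And>s. f (- s) = - f s"
  shows "primitive f (- t) = primitive f t"
proof -
  have "primitive (\<lambda>s. - 1 * f s) t = - 1 * primitive f t"
    by (rule primitive_cmult[OF assms(1)])
  moreover have "primitive (\<lambda>s. - 1 * f s) t = - primitive f (- t)"
    using primitive_reflect[OF assms(1), of t] by (simp only: assms(2) mult_minus1)
  ultimately show ?thesis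
    by (simp only: mult_minus1 neg_equal_iff_equal)
qed

lemma integral_oriented_char_primitive:
  assumes "f \<in> L1_loc"
  shows "(\<integral>s. oriented_char p q s * f s \<partial>lebesgue) = primitive f q - primitive f p"
  using primitive_diff[OF assms, of p q] primitive_diff[OF assms, of q p]
  by (auto simp: interval_integral_oriented_char interval_integral_eq_integral_L1_loc[OF assms])

lemma integrable_oriented_char:
  assumes "f \<in> L1_loc"
  shows "integrable lebesgue (\<lambda>s. oriented_char p q s * f s)"
proof -
  have "set_integrable lebesgue {p..q} f" "set_integrable lebesgue {q..<p} f"
    using L1_loc_Icc[OF assms] by (auto intro: set_integrable_subset[OF L1_loc_Icc[OF assms, of q p]])
  then have "integrable lebesgue (\<lambda>s. indicator {p..q} s *\<^sub>R f s - indicator {q..<p} s *\<^sub>R f s)"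
    by (simp add: set_integrable_def)
  moreover have "indicator {p..q} s *\<^sub>R f s - indicator {q..<p} s *\<^sub>R f s = oriented_char p q s * f s" for s
    by (auto simp: oriented_char_def indicator_def)
  ultimately show ?thesis by simp
qed

text \<open>
  Stating absolute continuity through increments, rather than for \<open>primitive f\<close>, also covers primitives with an
  arbitrary constant, in particular constants themselves (with \<open>f = 0\<close>).
\<close>

lemma continuous_if_increments_integral:
  assumes f: "f \<in> L1_loc" and F: "\<And>x y. x \<le> y \<Longrightarrow> F y - F x = integral {x..y} f"
  shows "continuous_on UNIV F"
proof -
  have "isCont F t" for t
  proof -
    have F': "F (t-1) + integral {t-1..x} f = F x" if "t-1 \<le> x" for x
      using F[OF that] by simp
    have "continuous_on {t-1..t+1} (\<lambda>x. F (t-1) + integral {t-1..x} f)"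
      by (intro continuous_intros indefinite_integral_continuous_1 L1_loc_integrable_on f)
    then have "continuous_on {t-1..t+1} F"
      by (rule continuous_on_eq) (simp add: F')
    then show ?thesis
      by (rule continuous_on_interior) simp
  qed
  then show ?thesis
    by (simp add: continuous_at_imp_continuous_on)
qed

lemma primitive_has_real_derivative:
  assumes f: "continuous_on UNIV f"
  shows "(primitive f has_real_derivative f t) (at t)"
proof -
  have f': "f \<in> L1_loc" by (rule L1_loc_continuous[OF f])
  have F': "primitive f (t-1) + integral {t-1..x} f = primitive f x" if "t-1 \<le> x" for x
    using primitive_diff[OF f' that] by simp
  have "((\<lambda>x. integral {t-1..x} f) has_real_derivative f t) (at t within {t-1..t+1})"
    by (rule integral_has_real_derivative) (auto intro: continuous_on_subset[OF f])
  then have "((\<lambda>x. primitive f (t-1) + integral {t-1..x} f) has_real_derivative f t) (at t within {t-1..t+1})"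
    by (auto intro!: derivative_eq_intros)
  then have "(primitive f has_real_derivative f t) (at t within {t-1..t+1})"
    by (rule has_field_derivative_transform_within[OF _ zero_less_one]) (simp_all add: F')
  moreover have "at t within {t-1..t+1} = at t"
    by (rule at_within_interior) simp
  ultimately show ?thesis by simp
qed

section \<open>Weak derivatives\<close>

text \<open>
  Fubini's theorem is applied to the completed measure itself: a locally integrable function
  need not be Borel, so it is not a legitimate integrand for \<open>lborel\<close>.
\<close>

lemma sigma_finite_lebesgue: "sigma_finite_measure (lebesgue :: real measure)"
proof
  show "\<exists>A. countable A \<and> A \<subseteq> sets lebesgue \<and> \<Union> A = space (lebesgue :: real measure)
      \<and> (\<forall>a\<in>A. emeasure lebesgue a \<noteq> \<infinity>)"
  proof (intro exI[of _ "range (\<lambda>n::nat. {- real n..real n})"] conjI)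
    show "\<Union> (range (\<lambda>n::nat. {- real n..real n})) = space lebesgue"
    proof -
      have "\<exists>n. - real n \<le> x \<and> x \<le> real n" for x
        using real_arch_simple[of "\<bar>x\<bar>"] by (auto simp: abs_le_iff minus_le_iff)
      then show ?thesis by auto
    qed
  qed auto
qed

text \<open>
  Both sides arise from one double integral of \<open>f(s) \<eta>'(t)\<close> over the triangle \<open>s \<le> t\<close> in the square
  \<open>[- R, R]\<^sup>2\<close>: integrating first in \<open>s\<close> gives \<open>F(t) - F(- R)\<close>, integrating first in \<open>t\<close>
  gives \<open>- \<eta>(s)\<close>.  The constant \<open>F(- R)\<close> disappears because \<open>\<eta>'\<close> has integral zero.
\<close>

lemma integration_by_parts_compact_support:
  fixes F f \<eta> \<eta>' :: "real \<Rightarrow> real"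
  assumes f: "f \<in> L1_loc" and F: "\<And>x y. x \<le> y \<Longrightarrow> F y - F x = integral {x..y} f"
    and \<eta>: "\<And>x. (\<eta> has_real_derivative \<eta>' x) (at x)" and \<eta>': "continuous_on UNIV \<eta>'"
    and R: "\<And>x. x \<notin> {-R<..<R} \<Longrightarrow> \<eta> x = 0 \<and> \<eta>' x = 0"
  shows "(\<integral>x. F x * \<eta>' x \<partial>lebesgue) = - (\<integral>x. f x * \<eta> x \<partial>lebesgue)"
proof -
  interpret L: pair_sigma_finite "lebesgue :: real measure" "lebesgue :: real measure"
    by (intro pair_sigma_finite.intro sigma_finite_lebesgue)
  have R0: "\<eta> (-R) = 0" "\<eta> R = 0"
    using R by simp_all
  define g where "g s = indicator {-R..R} s * f s" for s
  have g: "integrable lebesgue g"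
    using L1_loc_Icc[OF f, of "-R" R] by (simp add: g_def[abs_def] set_integrable_def)
  have e: "integrable lebesgue \<eta>'"
    by (rule integral_compact_support(1)[where R=R, OF L1_loc_continuous[OF \<eta>']]) (use R in auto)
  define k where "k s t = indicator {p. fst p \<le> snd p} (s, t) *\<^sub>R (g s * \<eta>' t)" for s t :: real
  have "integrable (lebesgue \<Otimes>\<^sub>M lebesgue) (\<lambda>(s, t). g s * \<eta>' t)"
  proof (rule L.Fubini_integrable)
    have [measurable]: "g \<in> borel_measurable lebesgue" "\<eta>' \<in> borel_measurable lebesgue"
      using g e by auto
    show "(\<lambda>(s, t). g s * \<eta>' t) \<in> borel_measurable (lebesgue \<Otimes>\<^sub>M lebesgue)"
      by measurable
    show "integrable lebesgue (\<lambda>x. \<integral>y. norm (case (x, y) of (s, t) \<Rightarrow> g s * \<eta>' t) \<partial>lebesgue)"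
      using g e by (simp add: abs_mult)
    show "AE x in lebesgue. integrable lebesgue (\<lambda>y. case (x, y) of (s, t) \<Rightarrow> g s * \<eta>' t)"
      using e by simp
  qed
  moreover have "{p. fst p \<le> snd p} \<in> sets (lebesgue \<Otimes>\<^sub>M lebesgue :: (real \<times> real) measure)"
  proof -
    have [measurable]: "(\<lambda>x. x) \<in> borel_measurable (lebesgue :: real measure)"
      by (rule measurable_completion) simp
    have "{p \<in> space (lebesgue \<Otimes>\<^sub>M lebesgue :: (real \<times> real) measure). fst p \<le> snd p}
        \<in> sets (lebesgue \<Otimes>\<^sub>M lebesgue)"
      by measurable
    then show ?thesis by (simp add: space_pair_measure)
  qed
  ultimately have "integrable (lebesgue \<Otimes>\<^sub>M lebesgue)
      (\<lambda>p. indicator {p. fst p \<le> snd p} p *\<^sub>R (case p of (s, t) \<Rightarrow> g s * \<eta>' t))"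
    by (intro integrable_mult_indicator)
  then have "integrable (lebesgue \<Otimes>\<^sub>M lebesgue) (case_prod k)"
    by (simp add: k_def case_prod_beta')
  from L.Fubini_integral[OF this]
  have swap: "(\<integral>t. (\<integral>s. k s t \<partial>lebesgue) \<partial>lebesgue) = (\<integral>s. (\<integral>t. k s t \<partial>lebesgue) \<partial>lebesgue)" .
  have inner1: "(\<integral>s. k s t \<partial>lebesgue) = (F t - F (-R)) * \<eta>' t" for t
  proof (cases "t \<in> {-R..R}")
    case True
    then have "k s t = (indicator {-R..t} s *\<^sub>R f s) * \<eta>' t" for s
      by (auto simp: k_def g_def indicator_def)
    then have "(\<integral>s. k s t \<partial>lebesgue) = (LINT s:{-R..t}|lebesgue. f s) * \<eta>' t"
      by (simp add: set_lebesgue_integral_def)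
    with True F[of "-R" t] show ?thesis
      by (simp add: set_lebesgue_integral_eq_integral(2)[OF L1_loc_Icc[OF f]])
  next
    case False
    then have "\<eta>' t = 0"
      using R[of t] by auto
    then show ?thesis by (simp add: k_def)
  qed
  have FTC: "(LINT t:{x..R}|lebesgue. \<eta>' t) = - \<eta> x" if "x \<le> R" for x
  proof -
    have "(\<eta>' has_integral (\<eta> R - \<eta> x)) {x..R}"
      using that \<eta> by (intro fundamental_theorem_of_calculus)
        (auto simp: has_real_derivative_iff_has_vector_derivative[symmetric] intro: has_field_derivative_at_within)
    then show ?thesis
      by (simp add: set_lebesgue_integral_eq_integral(2)[OF L1_loc_Icc[OF L1_loc_continuous[OF \<eta>']]]
          integral_unique R0)
  qed
  have inner2: "(\<integral>t. k s t \<partial>lebesgue) = - (f s * \<eta> s)" for s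
  proof (cases "s \<in> {-R..R}")
    case True
    have "k s t = f s * (indicator {s..R} t *\<^sub>R \<eta>' t)" for t
      using True R[of t] by (auto simp: k_def g_def indicator_def)
    then have "(\<integral>t. k s t \<partial>lebesgue) = f s * (LINT t:{s..R}|lebesgue. \<eta>' t)"
      by (simp add: set_lebesgue_integral_def)
    with True FTC[of s] show ?thesis by simp
  next
    case False
    then have "\<eta> s = 0"
      using R[of s] by auto
    with False show ?thesis by (simp add: k_def g_def)
  qed
  have Fc: "continuous_on UNIV F"
    by (rule continuous_if_increments_integral[OF f F])
  have iF: "integrable lebesgue (\<lambda>t. F t * \<eta>' t)"
    by (rule integral_compact_support(1)[where R=R])
      (use R in \<open>auto intro!: L1_loc_continuous continuous_intros Fc \<eta>'\<close>)
  have int0: "(\<integral>t. \<eta>' t \<partial>lebesgue) = 0"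
  proof -
    have "(\<integral>t. \<eta>' t \<partial>lebesgue) = (LINT t:{-R..R}|lebesgue. \<eta>' t)"
    proof -
      have "\<eta>' t = indicator {-R..R} t *\<^sub>R \<eta>' t" for t
      proof (cases "t \<in> {-R..R}")
        case False
        then have "\<eta>' t = 0"
          using R[of t] by auto
        then show ?thesis by simp
      qed simp
      then show ?thesis
        unfolding set_lebesgue_integral_def by (intro Bochner_Integration.integral_cong refl)
    qed
    also have "\<dots> = 0"
      using FTC[of "- R"] by (cases "- R \<le> R") (simp_all add: R0 set_lebesgue_integral_def)
    finally show ?thesis .
  qed
  have "(\<integral>x. F x * \<eta>' x \<partial>lebesgue) = (\<integral>t. (F t - F (-R)) * \<eta>' t \<partial>lebesgue)"
    using iF e by (simp add: left_diff_distrib int0)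
  also have "\<dots> = - (\<integral>x. f x * \<eta> x \<partial>lebesgue)"
    using swap by (simp add: inner1 inner2)
  finally show ?thesis .
qed

lemma test_functionD:
  assumes "test_function \<phi>"
  shows "(\<phi> has_real_derivative deriv \<phi> x) (at x)"
    and "continuous_on UNIV \<phi>" and "continuous_on UNIV (deriv \<phi>)"
    and "\<exists>R. \<forall>x. x \<notin> {-R<..<R} \<longrightarrow> \<phi> x = 0 \<and> deriv \<phi> x = 0"
proof -
  have "((deriv ^^ n) \<phi>) differentiable_on UNIV" for n
    using assms by (simp add: test_function_def)
  from this[of 0] this[of 1]
  have d: "\<phi> differentiable_on UNIV" "deriv \<phi> differentiable_on UNIV"
    by simp_all
  then show c: "continuous_on UNIV \<phi>" "continuous_on UNIV (deriv \<phi>)"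
    by (simp_all add: differentiable_imp_continuous_on)
  show "(\<phi> has_real_derivative deriv \<phi> x) (at x)" for x
    using d(1) by (simp add: DERIV_deriv_iff_real_differentiable differentiable_on_def)
  let ?S = "closure {x. \<phi> x \<noteq> 0}"
  have "bounded ?S"
    using assms by (simp add: test_function_def compact_imp_bounded)
  then obtain R where R: "\<And>x. x \<in> ?S \<Longrightarrow> \<bar>x\<bar> \<le> R"
    by (auto simp: bounded_iff)
  have "\<phi> x = 0 \<and> deriv \<phi> x = 0" if "x \<notin> {-(R+1)<..<R+1}" for x
  proof -
    have "x \<notin> ?S"
      using R[of x] that by auto
    then have x: "x \<in> - ?S" and *: "\<And>y. y \<in> - ?S \<Longrightarrow> 0 = \<phi> y"
      using closure_subset by force+
    have "(\<phi> has_real_derivative 0) (at x)"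
    proof (rule has_field_derivative_transform_within_open)
      show "((\<lambda>_. 0) has_real_derivative 0) (at x)" "open (- ?S)"
        by auto
    qed (fact x *)+
    then show ?thesis
      using *[OF x] by (simp add: DERIV_imp_deriv)
  qed
  then show "\<exists>R. \<forall>x. x \<notin> {-R<..<R} \<longrightarrow> \<phi> x = 0 \<and> deriv \<phi> x = 0"
    by blast
qed

lemma integrable_mult_test_function:
  assumes "f \<in> L1_loc" and "test_function \<phi>"
  shows "integrable lebesgue (\<lambda>x. f x * \<phi> x)" and "integrable lebesgue (\<lambda>x. f x * deriv \<phi> x)"
proof -
  from test_functionD(4)[OF assms(2)]
  obtain R where R: "\<And>x. x \<notin> {-R<..<R} \<Longrightarrow> \<phi> x = 0 \<and> deriv \<phi> x = 0"
    by blast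
  have R': "\<phi> x = 0 \<and> deriv \<phi> x = 0" if "x \<notin> {-R..R}" for x
    using that by (intro R) auto
  have L1: "(\<lambda>x. f x * \<phi> x) \<in> L1_loc" "(\<lambda>x. f x * deriv \<phi> x) \<in> L1_loc"
    using L1_loc_mult[OF test_functionD(2)[OF assms(2)] assms(1)]
      L1_loc_mult[OF test_functionD(3)[OF assms(2)] assms(1)]
    by (simp_all add: mult.commute)
  have zero: "f x * \<phi> x = 0" "f x * deriv \<phi> x = 0" if "x \<notin> {-R..R}" for x
    using R'[OF that] by simp_all
  show "integrable lebesgue (\<lambda>x. f x * \<phi> x)"
    by (rule integral_compact_support(1)[OF L1(1) zero(1)])
  show "integrable lebesgue (\<lambda>x. f x * deriv \<phi> x)"
    by (rule integral_compact_support(1)[OF L1(2) zero(2)])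
qed

text \<open>
  A product \<open>u \<phi>\<close> of a continuously differentiable function and a test function need not be smooth, but
  integration by parts applies to it all the same; the product rule for \<open>u \<phi>\<close> then becomes the product rule for
  \<open>u F\<close>.
\<close>

lemma weak_derivative_C1_mult:
  assumes f: "f \<in> L1_loc" and F: "\<And>x y. x \<le> y \<Longrightarrow> F y - F x = integral {x..y} f"
    and u: "\<And>x. (u has_real_derivative u' x) (at x)" and u': "continuous_on UNIV u'"
  shows "weak_derivative (\<lambda>x. u x * F x) (\<lambda>x. u' x * F x + u x * f x)"
proof -
  have Fc: "continuous_on UNIV F"
    by (rule continuous_if_increments_integral[OF f F])
  have uc: "continuous_on UNIV u"
    by (intro continuous_at_imp_continuous_on ballI DERIV_isCont[OF u])
  have L1: "(\<lambda>x. u x * F x) \<in> L1_loc" "(\<lambda>x. u' x * F x) \<in> L1_loc" "(\<lambda>x. u x * f x) \<in> L1_loc"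
    by (intro L1_loc_mult L1_loc_continuous uc u' Fc f)+
  show ?thesis
    unfolding weak_derivative_def
  proof (intro conjI allI impI)
    fix \<phi>
    assume \<phi>: "test_function \<phi>"
    then obtain R where R: "\<And>x. x \<notin> {-R<..<R} \<Longrightarrow> \<phi> x = 0 \<and> deriv \<phi> x = 0"
      using test_functionD(4) by blast
    have int: "integrable lebesgue (\<lambda>x. (u x * F x) * deriv \<phi> x)"
        "integrable lebesgue (\<lambda>x. (u' x * F x) * \<phi> x)" "integrable lebesgue (\<lambda>x. (u x * f x) * \<phi> x)"
      by (rule integrable_mult_test_function L1 \<phi>)+
    have "(\<integral>x. F x * (u' x * \<phi> x + deriv \<phi> x * u x) \<partial>lebesgue) = - (\<integral>x. f x * (u x * \<phi> x) \<partial>lebesgue)"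
    proof (rule integration_by_parts_compact_support[OF f F])
      show "((\<lambda>x. u x * \<phi> x) has_real_derivative u' x * \<phi> x + deriv \<phi> x * u x) (at x)" for x
        by (rule DERIV_mult[OF u test_functionD(1)[OF \<phi>]])
      show "continuous_on UNIV (\<lambda>x. u' x * \<phi> x + deriv \<phi> x * u x)"
        by (intro continuous_intros u' uc test_functionD(2,3)[OF \<phi>])
      show "u x * \<phi> x = 0 \<and> u' x * \<phi> x + deriv \<phi> x * u x = 0" if "x \<notin> {-R<..<R}" for x
        using R[OF that] by simp
    qed
    also have "(\<lambda>x. F x * (u' x * \<phi> x + deriv \<phi> x * u x))
        = (\<lambda>x. (u x * F x) * deriv \<phi> x + (u' x * F x) * \<phi> x)"
      by (auto simp: algebra_simps)
    also have "integral\<^sup>L lebesgue \<dots>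
        = (\<integral>x. (u x * F x) * deriv \<phi> x \<partial>lebesgue) + (\<integral>x. (u' x * F x) * \<phi> x \<partial>lebesgue)"
      by (rule Bochner_Integration.integral_add[OF int(1,2)])
    finally have "(\<integral>x. (u x * F x) * deriv \<phi> x \<partial>lebesgue)
        = - ((\<integral>x. (u' x * F x) * \<phi> x \<partial>lebesgue) + (\<integral>x. (u x * f x) * \<phi> x \<partial>lebesgue))"
      by (simp add: mult.assoc mult.left_commute)
    also have "\<dots> = - (\<integral>x. (u' x * F x + u x * f x) * \<phi> x \<partial>lebesgue)"
      by (simp only: distrib_right Bochner_Integration.integral_add[OF int(2,3)])
    finally show "(\<integral>x. (u x * F x) * deriv \<phi> x \<partial>lebesgue)
        = - (\<integral>x. (u' x * F x + u x * f x) * \<phi> x \<partial>lebesgue)" .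
  qed (rule L1(1), rule L1_loc_add[OF L1(2,3)])
qed

lemma weak_derivative_add:
  assumes "weak_derivative f f'" and "weak_derivative g g'"
  shows "weak_derivative (\<lambda>x. f x + g x) (\<lambda>x. f' x + g' x)"
proof -
  have L1: "f \<in> L1_loc" "f' \<in> L1_loc" "g \<in> L1_loc" "g' \<in> L1_loc"
    using assms by (simp_all add: weak_derivative_def)
  show ?thesis
    unfolding weak_derivative_def
  proof (intro conjI allI impI)
    fix \<phi>
    assume \<phi>: "test_function \<phi>"
    note int = integrable_mult_test_function[OF _ \<phi>]
    have "(\<integral>x. f x * deriv \<phi> x \<partial>lebesgue) = - (\<integral>x. f' x * \<phi> x \<partial>lebesgue)"
      "(\<integral>x. g x * deriv \<phi> x \<partial>lebesgue) = - (\<integral>x. g' x * \<phi> x \<partial>lebesgue)"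
      using assms \<phi> by (simp_all add: weak_derivative_def)
    then show "(\<integral>x. (f x + g x) * deriv \<phi> x \<partial>lebesgue) = - (\<integral>x. (f' x + g' x) * \<phi> x \<partial>lebesgue)"
      by (simp only: distrib_right int[OF L1(1)] int[OF L1(2)] int[OF L1(3)] int[OF L1(4)]
          Bochner_Integration.integral_add minus_add_distrib minus_diff_minus)
  qed (rule L1_loc_add[OF L1(1,3)], rule L1_loc_add[OF L1(2,4)])
qed

lemma weak_derivative_diff:
  assumes "weak_derivative f f'" and "weak_derivative g g'"
  shows "weak_derivative (\<lambda>x. f x - g x) (\<lambda>x. f' x - g' x)"
proof -
  have L1: "f \<in> L1_loc" "f' \<in> L1_loc" "g \<in> L1_loc" "g' \<in> L1_loc"
    using assms by (simp_all add: weak_derivative_def)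
  show ?thesis
    unfolding weak_derivative_def
  proof (intro conjI allI impI)
    fix \<phi>
    assume \<phi>: "test_function \<phi>"
    note int = integrable_mult_test_function[OF _ \<phi>]
    have "(\<integral>x. f x * deriv \<phi> x \<partial>lebesgue) = - (\<integral>x. f' x * \<phi> x \<partial>lebesgue)"
      "(\<integral>x. g x * deriv \<phi> x \<partial>lebesgue) = - (\<integral>x. g' x * \<phi> x \<partial>lebesgue)"
      using assms \<phi> by (simp_all add: weak_derivative_def)
    then show "(\<integral>x. (f x - g x) * deriv \<phi> x \<partial>lebesgue) = - (\<integral>x. (f' x - g' x) * \<phi> x \<partial>lebesgue)"
      by (simp only: left_diff_distrib int[OF L1(1)] int[OF L1(2)] int[OF L1(3)] int[OF L1(4)]
          Bochner_Integration.integral_diff minus_add_distrib minus_diff_minus)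
  qed (rule L1_loc_diff[OF L1(1,3)], rule L1_loc_diff[OF L1(2,4)])
qed

section \<open>Smooth bumps and the lemma of du Bois-Reymond\<close>

text \<open>
  Differentiating the classical flat function \<open>exp (- 1 / x)\<close> produces factors \<open>1 / x\<close>; with these powers
  included, the family is closed under differentiation up to linear combinations.
\<close>

definition flat :: "nat \<Rightarrow> real \<Rightarrow> real" where
  "flat k x = (if 0 < x then (1 / x) ^ k * exp (- (1 / x)) else 0)"

lemma flat_tendsto_0: "(flat k \<longlongrightarrow> 0) (at 0)"
proof -
  have "((\<lambda>x. inverse x ^ k / exp (inverse x)) \<longlongrightarrow> (0::real)) (at_right 0)"
    by (rule filterlim_compose[OF tendsto_power_div_exp_0 filterlim_inverse_at_top_right])
  moreover have "\<forall>\<^sub>F x in at_right 0. inverse x ^ k / exp (inverse x) = flat k x"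
    by (rule eventually_at_rightI[of 0 1])
      (auto simp: flat_def exp_minus inverse_eq_divide divide_simps)
  ultimately have "(flat k \<longlongrightarrow> 0) (at_right 0)"
    by (rule Lim_transform_eventually)
  moreover have "(flat k \<longlongrightarrow> 0) (at_left 0)"
    by (rule Lim_transform_eventually[OF tendsto_const])
      (auto simp: flat_def intro!: eventually_at_leftI[of "-1"])
  ultimately show ?thesis
    using filterlim_split_at by blast
qed

text \<open>
  At the origin the difference quotient of \<open>flat k\<close> is \<open>flat (k + 1)\<close>, which tends to zero.
\<close>

lemma flat_has_real_derivative:
  "(flat k has_real_derivative flat (k + 2) x - real k * flat (k + 1) x) (at x)"
proof -
  consider "0 < x" | "x < 0" | "x = 0"
    by linarith
  then show ?thesis
  proof cases
    case 1
    have "((\<lambda>x. 1 / x) has_real_derivative - ((1 / x)\<^sup>2)) (at x)"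
      using 1 by (auto intro!: derivative_eq_intros simp: power2_eq_square)
    moreover have "((\<lambda>y. y ^ k * exp (- y)) has_real_derivative
        real k * y ^ (k - 1) * exp (- y) - y ^ k * exp (- y)) (at y)" for y :: real
      by (auto intro!: derivative_eq_intros)
    ultimately have "((\<lambda>x. (1 / x) ^ k * exp (- (1 / x))) has_real_derivative
        (real k * (1 / x) ^ (k - 1) * exp (- (1 / x)) - (1 / x) ^ k * exp (- (1 / x)))
          * - ((1 / x)\<^sup>2)) (at x)"
      by (rule DERIV_chain2[rotated])
    also have "(real k * (1 / x) ^ (k - 1) * exp (- (1 / x)) - (1 / x) ^ k * exp (- (1 / x)))
          * - ((1 / x)\<^sup>2) = flat (k + 2) x - real k * flat (k + 1) x"
      using 1 by (cases k) (simp_all add: flat_def power2_eq_square algebra_simps add_divide_distrib)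
    finally have "((\<lambda>x. (1 / x) ^ k * exp (- (1 / x))) has_real_derivative
        flat (k + 2) x - real k * flat (k + 1) x) (at x)" .
    then show ?thesis
      by (rule has_field_derivative_transform_within_open[where S="{0<..}"])
        (use 1 in \<open>auto simp: flat_def\<close>)
  next
    case 2
    have "((\<lambda>x. 0) has_real_derivative flat (k + 2) x - real k * flat (k + 1) x) (at x)"
      using 2 by (simp add: flat_def)
    then show ?thesis
      by (rule has_field_derivative_transform_within_open[where S="{..<0}"])
        (use 2 in \<open>auto simp: flat_def\<close>)
  next
    case 3
    have "((\<lambda>h. (flat k (0 + h) - flat k 0) / h) \<longlongrightarrow> 0) (at 0)"
    proof (rule Lim_transform_eventually[OF flat_tendsto_0[of "Suc k"]])
      show "\<forall>\<^sub>F h in at 0. flat (Suc k) h = (flat k (0 + h) - flat k 0) / h"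
        by (simp add: flat_def eventually_at_filter)
    qed
    with 3 show ?thesis
      by (simp add: DERIV_def flat_def)
  qed
qed

text \<open>
  Smoothness is obtained for a whole algebra of functions at once: since the derivative stays in the algebra,
  derivatives of all orders exist.
\<close>

inductive flat_algebra :: "(real \<Rightarrow> real) \<Rightarrow> bool" where
  flat: "flat_algebra (\<lambda>x. flat k (c * x + d))"
| const: "flat_algebra (\<lambda>x. c)"
| add: "flat_algebra f \<Longrightarrow> flat_algebra g \<Longrightarrow> flat_algebra (\<lambda>x. f x + g x)"
| mult: "flat_algebra f \<Longrightarrow> flat_algebra g \<Longrightarrow> flat_algebra (\<lambda>x. f x * g x)"

lemma flat_algebra_derivative:
  assumes "flat_algebra f"
  shows "\<exists>f'. flat_algebra f' \<and> (\<forall>x. (f has_real_derivative f' x) (at x))"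
  using assms
proof induction
  case (flat k c d)
  let ?f' = "\<lambda>x. c * (flat (k + 2) (c * x + d) + (- real k) * flat (k + 1) (c * x + d))"
  have "flat_algebra ?f'"
    by (intro flat_algebra.intros)
  moreover have "((\<lambda>x. flat k (c * x + d)) has_real_derivative ?f' x) (at x)" for x
  proof -
    have "((\<lambda>x. c * x + d) has_real_derivative c) (at x)"
      by (auto intro!: derivative_eq_intros)
    from DERIV_chain2[OF flat_has_real_derivative this] show ?thesis
      by (simp add: mult.commute)
  qed
  ultimately show ?case by blast
next
  case (const c)
  show ?case
    by (rule exI[of _ "\<lambda>_. 0"]) (auto intro: flat_algebra.const)
next
  case (add f g)
  then obtain f' g' where "flat_algebra f'" "flat_algebra g'"
    and "\<And>x. (f has_real_derivative f' x) (at x)" "\<And>x. (g has_real_derivative g' x) (at x)"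
    by blast
  then show ?case
    by (intro exI[of _ "\<lambda>x. f' x + g' x"]) (auto intro: flat_algebra.add DERIV_add)
next
  case (mult f g)
  then obtain f' g' where "flat_algebra f'" "flat_algebra g'"
    and "\<And>x. (f has_real_derivative f' x) (at x)" "\<And>x. (g has_real_derivative g' x) (at x)"
    by blast
  with mult show ?case
    by (intro exI[of _ "\<lambda>x. f' x * g x + g' x * f x"])
      (auto intro!: flat_algebra.add flat_algebra.mult DERIV_mult)
qed

lemma flat_algebra_deriv:
  assumes "flat_algebra f"
  shows "flat_algebra (deriv f)" and "f differentiable_on UNIV"
proof -
  obtain f' where f': "flat_algebra f'" "\<And>x. (f has_real_derivative f' x) (at x)"
    using flat_algebra_derivative[OF assms] by blast
  then have "deriv f = f'"
    by (simp add: DERIV_imp_deriv fun_eq_iff)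
  with f' show "flat_algebra (deriv f)" by simp
  show "f differentiable_on UNIV"
    using f'(2) real_differentiable_def by (force simp: differentiable_on_def)
qed

lemma flat_algebra_deriv_iterate: "flat_algebra f \<Longrightarrow> flat_algebra ((deriv ^^ n) f)"
  by (induction n) (simp_all add: flat_algebra_deriv)

lemma exists_smooth_bump:
  assumes "0 < d"
  obtains \<eta> where "flat_algebra \<eta>" and "\<And>x. 0 \<le> \<eta> x" and "\<eta> 0 \<noteq> 0"
    and "\<And>x. x \<notin> {-d<..<d} \<Longrightarrow> \<eta> x = 0"
proof
  \<comment> \<open>Positive exactly on \<open>{-d<..<d}\<close>; written so that both factors match the affine generators.\<close>
  show "flat_algebra (\<lambda>x. flat 0 (1 * x + d) * flat 0 ((-1) * x + d))"
    by (intro flat_algebra.intros)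
qed (use assms in \<open>auto simp: flat_def\<close>)

text \<open>
  The function \<open>\<phi>\<close> is a difference of two translates of a primitive of the bump.  The primitive takes one
  constant value to the left of the bump and another to its right, so far out the translates agree and \<open>\<phi>\<close>
  has compact support.  It is tailored to compare averages of a function near \<open>x\<close> and near \<open>y\<close>.
\<close>

lemma test_function_step:
  assumes "flat_algebra \<eta>" and "\<And>x. x \<notin> {-d<..<d} \<Longrightarrow> \<eta> x = 0"
  obtains \<phi> where "test_function \<phi>" and "deriv \<phi> = (\<lambda>t. \<eta> (t - y) - \<eta> (t - x))"
    and "(\<integral>t. deriv \<phi> t \<partial>lebesgue) = 0"
proof -
  have \<eta>c: "continuous_on UNIV \<eta>"
    by (intro differentiable_imp_continuous_on flat_algebra_deriv assms)
  define E where "E t = primitive \<eta> t" for t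
  have E: "(E has_real_derivative \<eta> t) (at t)" for t
    unfolding E_def[abs_def] by (rule primitive_has_real_derivative[OF \<eta>c])
  \<comment> \<open>Outside its support the bump contributes nothing, so \<open>E\<close> is constant on either side.\<close>
  have E_right: "E t = E d" if "d \<le> t" for t
  proof -
    have "E t - E d = integral {d..t} \<eta>"
      unfolding E_def using that by (rule primitive_diff[OF L1_loc_continuous[OF \<eta>c]])
    also have "\<dots> = integral {d..t} (\<lambda>_. 0)"
      by (rule Henstock_Kurzweil_Integration.integral_cong) (use assms in auto)
    finally show ?thesis by simp
  qed
  have E_left: "E t = E (-d)" if "t \<le> -d" for t
  proof -
    have "E (-d) - E t = integral {t..-d} \<eta>"
      unfolding E_def using that by (rule primitive_diff[OF L1_loc_continuous[OF \<eta>c]])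
    also have "\<dots> = integral {t..-d} (\<lambda>_. 0)"
      by (rule Henstock_Kurzweil_Integration.integral_cong) (use assms in auto)
    finally show ?thesis by simp
  qed
  define \<phi> where "\<phi> t = E (t - y) - E (t - x)" for t
  have \<phi>': "(\<phi> has_real_derivative \<eta> (t - y) - \<eta> (t - x)) (at t)" for t
  proof -
    have "((\<lambda>t. t - z) has_real_derivative 1) (at t)" for z
      by (auto intro!: derivative_eq_intros)
    then have "((\<lambda>t. E (t - z)) has_real_derivative \<eta> (t - z)) (at t)" for z
      using DERIV_chain2[OF E, where g="\<lambda>t. t - z"] by fastforce
    then show ?thesis
      unfolding \<phi>_def by (intro DERIV_diff)
  qed
  then have deriv: "deriv \<phi> = (\<lambda>t. \<eta> (t - y) - \<eta> (t - x))"
    by (simp add: DERIV_imp_deriv fun_eq_iff)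
  have shift: "flat_algebra (\<lambda>t. \<eta> (t - z))" for z
    using assms(1)
  proof induction
    case (flat k c e)
    have "(\<lambda>t. flat k (c * (t - z) + e)) = (\<lambda>t. flat k (c * t + (e - c * z)))"
      by (simp add: algebra_simps)
    then show ?case by (simp only: flat_algebra.flat)
  qed (auto intro: flat_algebra.intros)
  have "flat_algebra (\<lambda>t. \<eta> (t - y) + (-1) * \<eta> (t - x))"
    by (intro flat_algebra.intros shift)
  then have alg: "flat_algebra (deriv \<phi>)"
    by (simp add: deriv)
  let ?R = "\<bar>d\<bar> + \<bar>x\<bar> + \<bar>y\<bar>"
  have supp: "\<phi> t = 0" if "t \<notin> {-?R<..<?R}" for t
  proof -
    have "(d \<le> t - x \<and> d \<le> t - y) \<or> (t - x \<le> -d \<and> t - y \<le> -d)"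
      using that by auto
    then show ?thesis
      using E_left[of "t - x"] E_left[of "t - y"] E_right[of "t - x"] E_right[of "t - y"]
      by (auto simp: \<phi>_def)
  qed
  have test: "test_function \<phi>"
    unfolding test_function_def
  proof (intro conjI allI)
    show "(deriv ^^ n) \<phi> differentiable_on UNIV" for n
    proof (cases n)
      case 0
      then show ?thesis
        using \<phi>' real_differentiable_def by (force simp: differentiable_on_def)
    next
      case (Suc m)
      then show ?thesis
        using flat_algebra_deriv(2)[OF flat_algebra_deriv_iterate[OF alg, of m]]
        by (simp add: funpow_swap1)
    qed
    have "{t. \<phi> t \<noteq> 0} \<subseteq> {-?R<..<?R}"
      using supp by blast
    also have "\<dots> \<subseteq> {-?R..?R}"
      by auto
    finally show "compact (closure {t. \<phi> t \<noteq> 0})"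
      using bounded_closed_interval bounded_subset compact_closure by blast
  qed
  have "(\<integral>t. 1 * deriv \<phi> t \<partial>lebesgue) = - (\<integral>t. 0 * \<phi> t \<partial>lebesgue)"
  proof (rule integration_by_parts_compact_support)
    show "\<phi> t = 0 \<and> deriv \<phi> t = 0" if "t \<notin> {-?R<..<?R}" for t
    proof -
      have "t - x \<notin> {-d<..<d}" "t - y \<notin> {-d<..<d}"
        using that by auto
      then show ?thesis
        using supp[OF that] assms(2) by (simp add: deriv)
    qed
  qed (auto intro: L1_loc_continuous test_functionD test)
  with test deriv show ?thesis
    by (intro that[of \<phi>]) simp_all
qed

text \<open>
  If \<open>f x < m < f y\<close>, test with a step whose derivative is a narrow bump at \<open>y\<close> minus the same bump at \<open>x\<close>.
  Then \<open>(f - m) \<phi>'\<close> is nonnegative, continuous and not identically zero, although its integral vanishes.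
\<close>

lemma du_bois_reymond:
  assumes f: "continuous_on UNIV f"
    and zero: "\<And>\<phi>. test_function \<phi> \<Longrightarrow> (\<integral>t. f t * deriv \<phi> t \<partial>lebesgue) = 0"
  shows "f x = f y"
proof -
  have False if "f x < f y" for x y
  proof -
    define m where "m = (f x + f y) / 2"
    have m: "f x < m" "m < f y"
      using that by (simp_all add: m_def)
    have "\<exists>d>0. \<forall>t. \<bar>t - z\<bar> < d \<longrightarrow> \<bar>f t - f z\<bar> < e" if "0 < e" for z e
      using f that by (auto simp: continuous_on_iff dist_real_def)
    from this[of "m - f x" x] this[of "f y - m" y] m
    obtain d1 d2 where "0 < d1" "0 < d2"
      and d1: "\<And>t. \<bar>t - x\<bar> < d1 \<Longrightarrow> \<bar>f t - f x\<bar> < m - f x"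
      and d2: "\<And>t. \<bar>t - y\<bar> < d2 \<Longrightarrow> \<bar>f t - f y\<bar> < f y - m"
      by (metis diff_gt_0_iff_gt)
    define d where "d = min d1 d2"
    have "0 < d"
      using \<open>0 < d1\<close> \<open>0 < d2\<close> by (simp add: d_def)
    from exists_smooth_bump[OF this]
    obtain \<eta> where \<eta>: "flat_algebra \<eta>" "\<And>t. 0 \<le> \<eta> t" "\<eta> 0 \<noteq> 0"
      and supp: "\<And>t. t \<notin> {-d<..<d} \<Longrightarrow> \<eta> t = 0"
      by blast
    obtain \<phi> where \<phi>: "test_function \<phi>" and \<phi>': "deriv \<phi> = (\<lambda>t. \<eta> (t - y) - \<eta> (t - x))"
      and int0: "(\<integral>t. deriv \<phi> t \<partial>lebesgue) = 0"
      using test_function_step[OF \<eta>(1) supp] by blast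
    obtain R where R: "\<And>t. t \<notin> {-R<..<R} \<Longrightarrow> \<phi> t = 0 \<and> deriv \<phi> t = 0"
      using test_functionD(4)[OF \<phi>] by blast
    let ?g = "\<lambda>t. (f t - m) * deriv \<phi> t"
    \<comment> \<open>On the bump at \<open>y\<close> the factor \<open>f - m\<close> is positive, on the one at \<open>x\<close> it is negative.\<close>
    have nonneg: "0 \<le> ?g t" for t
    proof -
      have "0 \<le> (f t - m) * \<eta> (t - y)"
      proof (cases "\<bar>t - y\<bar> < d")
        case True
        then show ?thesis
          using d2[of t] \<eta>(2)[of "t - y"] by (simp add: d_def)
      next
        case False
        then have "t - y \<notin> {-d<..<d}"
          by auto
        from supp[OF this] show ?thesis by simp
      qed
      moreover have "(f t - m) * \<eta> (t - x) \<le> 0"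
      proof (cases "\<bar>t - x\<bar> < d")
        case True
        then show ?thesis
          using d1[of t] \<eta>(2)[of "t - x"] by (simp add: d_def mult_nonpos_nonneg)
      next
        case False
        then have "t - x \<notin> {-d<..<d}"
          by auto
        from supp[OF this] show ?thesis by simp
      qed
      ultimately show ?thesis
        by (simp add: \<phi>' right_diff_distrib)
    qed
    have gc: "continuous_on UNIV ?g"
      by (intro continuous_intros f test_functionD \<phi>)
    have gy: "?g y \<noteq> 0"
    proof -
      \<comment> \<open>The bump at \<open>x\<close> does not reach \<open>y\<close>: there \<open>f\<close> stays below \<open>m\<close>.\<close>
      have "\<eta> (y - x) = 0"
      proof (rule ccontr)
        assume "\<eta> (y - x) \<noteq> 0"
        then have "y - x \<in> {-d<..<d}"
          using supp by blast
        then have "\<bar>y - x\<bar> < d1"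
          by (auto simp: d_def)
        from d1[OF this] m show False by simp
      qed
      with m \<eta>(3) show ?thesis by (simp add: \<phi>')
    qed
    then have y: "y \<in> {-R<..<R}"
      using R[of y] by fastforce
    then have "-R < R"
      by auto
    have "(\<integral>t. ?g t \<partial>lebesgue) = 0"
      using integrable_mult_test_function(2)[OF L1_loc_continuous[OF f] \<phi>]
        integrable_mult_test_function(2)[OF L1_loc_continuous[OF continuous_on_const[of UNIV m]] \<phi>]
      by (simp add: left_diff_distrib zero[OF \<phi>] int0)
    moreover have "(\<integral>t. ?g t \<partial>lebesgue) = integral {-R..R} ?g"
      by (rule integral_compact_support(2)) (use R in \<open>auto intro: L1_loc_continuous gc\<close>)
    ultimately have "integral {-R..R} ?g = 0" by simp
    then have "\<forall>t\<in>{-R..R}. ?g t = 0"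
      using integral_eq_0_iff[of "-R" R ?g] \<open>-R < R\<close> nonneg continuous_on_subset[OF gc] by simp
    moreover have "y \<in> {-R..R}"
      using y by auto
    ultimately show False
      using gy by blast
  qed
  then show ?thesis
    using linorder_neq_iff by blast
qed

text \<open>
  The difference \<open>f - primitive g\<close> has weak derivative zero, so it is constant.
\<close>

lemma weak_derivative_imp_primitive:
  assumes f: "continuous_on UNIV f" and g: "weak_derivative f g"
  shows "f t = f 0 + primitive g t"
proof -
  have g': "g \<in> L1_loc"
    using g by (simp add: weak_derivative_def)
  note inc = primitive_diff[OF g']
  have "continuous_on UNIV (\<lambda>t. f t - primitive g t)"
    by (intro continuous_intros f continuous_if_increments_integral[OF g' inc])
  moreover have "(\<integral>t. (f t - primitive g t) * deriv \<phi> t \<partial>lebesgue) = 0" if \<phi>: "test_function \<phi>" for \<phi>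
  proof -
    have "weak_derivative (\<lambda>t. 1 * primitive g t) (\<lambda>t. 0 * primitive g t + 1 * g t)"
      by (rule weak_derivative_C1_mult[OF g' inc]) simp_all
    from weak_derivative_diff[OF g this] \<phi> show ?thesis
      by (simp add: weak_derivative_def)
  qed
  ultimately have "f t - primitive g t = f 0 - primitive g 0"
    by (rule du_bois_reymond)
  then show ?thesis by simp
qed

section \<open>The reflection equation in even and odd parts\<close>

lemma reflection_ode_parity:
  assumes z: "\<And>t. (z has_real_derivative (- a * z (- t) - b * z t)) (at t)"
  shows "(even_part z has_real_derivative (a - b) * odd_part z t) (at t)"
    and "(odd_part z has_real_derivative - (a + b) * even_part z t) (at t)"
proof -
  have neg: "((\<lambda>t. - t) has_real_derivative - 1) (at t)"
    by (auto intro!: derivative_eq_intros)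
  have z': "((\<lambda>t. z (- t)) has_real_derivative (- a * z t - b * z (- t)) * - 1) (at t)"
    using DERIV_chain2[OF z neg] by simp
  have "((\<lambda>t. (z t + z (- t)) / 2) has_real_derivative
      ((- a * z (- t) - b * z t) + (- a * z t - b * z (- t)) * - 1) / 2) (at t)"
    by (intro DERIV_cdivide DERIV_add z z')
  then show "(even_part z has_real_derivative (a - b) * odd_part z t) (at t)"
    unfolding even_part_def[abs_def] odd_part_def
    by (rule back_subst) (simp add: field_simps)
  have "((\<lambda>t. (z t - z (- t)) / 2) has_real_derivative
      ((- a * z (- t) - b * z t) - (- a * z t - b * z (- t)) * - 1) / 2) (at t)"
    by (intro DERIV_cdivide DERIV_diff z z')
  then show "(odd_part z has_real_derivative - (a + b) * even_part z t) (at t)"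
    unfolding odd_part_def[abs_def] even_part_def
    by (rule back_subst) (simp add: field_simps)
qed

text \<open>
  Replacing \<open>a\<close> by \<open>- a\<close> interchanges the roles of the even and the odd part in the first order
  system.  The expression is therefore the Wronskian of two solutions of one trace-free system.
\<close>

lemma parity_determinant_const:
  assumes z: "\<And>t. (z has_real_derivative (- a * z (- t) - b * z t)) (at t)"
    and v: "\<And>t. (v has_real_derivative (a * v (- t) - b * v t)) (at t)"
  shows "even_part z t * even_part v t - odd_part z t * odd_part v t = z 0 * v 0"
proof -
  have v': "\<And>t. (v has_real_derivative (- (- a) * v (- t) - b * v t)) (at t)"
    using v by simp
  have "((\<lambda>t. even_part z t * even_part v t - odd_part z t * odd_part v t) has_real_derivative 0) (at t)" for t
    by (rule derivative_eq_intros reflection_ode_parity[OF z] reflection_ode_parity[OF v'] refl)+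
      (simp add: algebra_simps)
  then have "even_part z t * even_part v t - odd_part z t * odd_part v t
      = even_part z 0 * even_part v 0 - odd_part z 0 * odd_part v 0"
    by (intro DERIV_isconst_all) simp
  then show ?thesis
    by (simp add: even_part_def odd_part_def)
qed

text \<open>
  The Wronskian is constant, and at \<open>t = 0\<close> both odd parts vanish.
\<close>

lemma parity_wronskian_zero:
  assumes z: "\<And>t. (z has_real_derivative (- a * z (- t) - b * z t)) (at t)"
    and u: "\<And>t. (u has_real_derivative (- a * u (- t) - b * u t)) (at t)"
  shows "even_part z t * odd_part u t = odd_part z t * even_part u t"
proof -
  have "((\<lambda>t. even_part z t * odd_part u t - odd_part z t * even_part u t) has_real_derivative 0) (at t)" for t
    by (rule derivative_eq_intros reflection_ode_parity[OF z] reflection_ode_parity[OF u] refl)+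
      (simp add: algebra_simps)
  then have "even_part z t * odd_part u t - odd_part z t * even_part u t
      = even_part z 0 * odd_part u 0 - odd_part z 0 * even_part u 0"
    by (intro DERIV_isconst_all) simp
  then show ?thesis
    by (simp add: odd_part_def)
qed

text \<open>
  The relations of \<open>parity_determinant_const\<close> and \<open>parity_wronskian_zero\<close> determine the even and the odd
  part of \<open>z\<close> by Cramer's rule.
\<close>

lemma reflection_ode_unique:
  assumes z: "\<And>t. (z has_real_derivative (- a * z (- t) - b * z t)) (at t)"
    and u: "\<And>t. (u has_real_derivative (- a * u (- t) - b * u t)) (at t)" "u 0 = 1"
    and v: "\<And>t. (v has_real_derivative (a * v (- t) - b * v t)) (at t)" "v 0 = 1"
  shows "z t = z 0 * u t"
proof -
  let ?ze = "even_part z t" and ?zo = "odd_part z t"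
  let ?ue = "even_part u t" and ?uo = "odd_part u t"
  let ?ve = "even_part v t" and ?vo = "odd_part v t"
  have D: "?ue * ?ve - ?uo * ?vo = 1"
    using parity_determinant_const[OF u(1) v(1)] u(2) v(2) by simp
  have W: "?ze * ?uo = ?zo * ?ue"
    by (rule parity_wronskian_zero[OF z u(1)])
  have Z: "?ze * ?ve - ?zo * ?vo = z 0"
    using parity_determinant_const[OF z v(1)] v(2) by simp
  have "?ze = z 0 * ?ue" "?zo = z 0 * ?uo"
    using D W Z by algebra+
  moreover have "z t = ?ze + ?zo" "u t = ?ue + ?uo"
    by (simp_all add: even_part_def odd_part_def field_simps)
  ultimately show ?thesis
    by (simp add: distrib_left)
qed

section \<open>Variation of parameters and Green's function\<close>

lemma L1_loc_parity:
  assumes "f \<in> L1_loc"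
  shows "even_part f \<in> L1_loc" and "odd_part f \<in> L1_loc"
proof -
  have "(\<lambda>x. 1 / 2 * (f x + f (- x))) \<in> L1_loc" "(\<lambda>x. 1 / 2 * (f x - f (- x))) \<in> L1_loc"
    by (rule L1_loc_mult[OF continuous_on_const] L1_loc_add L1_loc_diff assms L1_loc_reflect)+
  then show "even_part f \<in> L1_loc" "odd_part f \<in> L1_loc"
    by (simp_all add: even_part_def[abs_def] odd_part_def[abs_def])
qed

lemma continuous_parity:
  fixes f :: "real \<Rightarrow> real"
  assumes "continuous_on UNIV f"
  shows "continuous_on UNIV (even_part f)" and "continuous_on UNIV (odd_part f)"
proof -
  have "continuous_on UNIV (\<lambda>x. f (- x))"
    by (intro continuous_on_compose2[OF assms] continuous_intros) auto
  then show "continuous_on UNIV (even_part f)" "continuous_on UNIV (odd_part f)"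
    unfolding even_part_def[abs_def] odd_part_def[abs_def]
    by (intro continuous_intros assms; simp)+
qed

text \<open>
  The pair \<open>(coeff_u v h, coeff_v u h)\<close> is the solution of \<open>u \<phi> + v \<psi> = h\<close> with \<open>\<phi>\<close> odd
  and \<open>\<psi>\<close> even, by Cramer's rule when the determinant \<open>u\<^sub>e v\<^sub>e - u\<^sub>o v\<^sub>o\<close> is \<open>1\<close>.
\<close>

definition coeff_u :: "(real \<Rightarrow> real) \<Rightarrow> (real \<Rightarrow> real) \<Rightarrow> real \<Rightarrow> real" where
  "coeff_u v h s = odd_part h s * even_part v s - even_part h s * odd_part v s"

definition coeff_v :: "(real \<Rightarrow> real) \<Rightarrow> (real \<Rightarrow> real) \<Rightarrow> real \<Rightarrow> real" where
  "coeff_v u h s = even_part h s * even_part u s - odd_part h s * odd_part u s"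

lemma coeff_L1_loc:
  assumes "h \<in> L1_loc" and "continuous_on UNIV v"
  shows "coeff_u v h \<in> L1_loc" and "coeff_v v h \<in> L1_loc"
proof -
  have "(\<lambda>s. even_part v s * odd_part h s - odd_part v s * even_part h s) \<in> L1_loc"
    "(\<lambda>s. even_part v s * even_part h s - odd_part v s * odd_part h s) \<in> L1_loc"
    by (rule L1_loc_diff L1_loc_mult L1_loc_parity continuous_parity assms)+
  then show "coeff_u v h \<in> L1_loc" "coeff_v v h \<in> L1_loc"
    by (simp_all add: coeff_u_def[abs_def] coeff_v_def[abs_def] mult.commute)
qed

lemma coeff_uminus: "coeff_u v h (- s) = - coeff_u v h s" "coeff_v u h (- s) = coeff_v u h s"
  by (simp_all add: coeff_u_def coeff_v_def even_part_def odd_part_def field_simps)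

lemma continuous_reflect:
  fixes f :: "real \<Rightarrow> real"
  assumes "continuous_on UNIV f"
  shows "continuous_on UNIV (\<lambda>t. f (- t))"
  by (intro continuous_on_compose2[OF assms] continuous_intros) auto

text \<open>
  Green's function integrates \<open>h\<close> over \<open>[0, t]\<close> and over \<open>[- t, 0]\<close>.  Reflecting the second interval
  onto the first one combines \<open>h(s)\<close> and \<open>h(- s)\<close> into its even and odd parts.
\<close>

lemma Green_integral:
  assumes h: "h \<in> L1_loc" and u: "continuous_on UNIV u" and v: "continuous_on UNIV v"
  shows "(\<integral>s. Green u v t s * h s \<partial>lebesgue)
    = u t * primitive (coeff_u v h) t + v t * primitive (coeff_v u h) t"
proof -
  define k1 where "k1 s = (u (- s) * v t + v (- s) * u t) * h s" for s
  define k2 where "k2 s = (u (- s) * v t - v (- s) * u t) * h s" for s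
  have k: "k1 \<in> L1_loc" "k2 \<in> L1_loc"
    unfolding k1_def[abs_def] k2_def[abs_def]
    by (intro L1_loc_mult h continuous_intros continuous_reflect u v)+
  note k2r = L1_loc_reflect[OF k(2)]
  have L1: "(\<lambda>s. u t * coeff_u v h s) \<in> L1_loc" "(\<lambda>s. v t * coeff_v u h s) \<in> L1_loc"
    by (rule L1_loc_mult[OF continuous_on_const] coeff_L1_loc h u v)+
  have "(\<integral>s. Green u v t s * h s \<partial>lebesgue)
      = (\<integral>s. 1 / 2 * (oriented_char 0 t s * k1 s + oriented_char (- t) 0 s * k2 s) \<partial>lebesgue)"
    by (rule Bochner_Integration.integral_cong) (simp_all add: Green_def k1_def k2_def algebra_simps)
  also have "\<dots> = 1 / 2 * (primitive k1 t - primitive k2 (- t))"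
    using integrable_oriented_char[OF k(1), of 0 t] integrable_oriented_char[OF k(2), of "- t" 0]
      integral_oriented_char_primitive[OF k(1), of 0 t]
      integral_oriented_char_primitive[OF k(2), of "- t" 0]
    by (simp flip: zero_ereal_def)
  also have "\<dots> = 1 / 2 * (primitive k1 t + primitive (\<lambda>s. k2 (- s)) t)"
    by (simp add: primitive_reflect[OF k(2)])
  also have "\<dots> = primitive (\<lambda>s. 1 / 2 * (k1 s + k2 (- s))) t"
    by (simp only: primitive_cmult[OF L1_loc_add[OF k(1) k2r]] primitive_add[OF k(1) k2r])
  also have "(\<lambda>s. 1 / 2 * (k1 s + k2 (- s))) = (\<lambda>s. u t * coeff_u v h s + v t * coeff_v u h s)"
    by (simp add: fun_eq_iff k1_def k2_def coeff_u_def coeff_v_def even_part_def odd_part_def field_simps)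
  also have "primitive \<dots> t = u t * primitive (coeff_u v h) t + v t * primitive (coeff_v u h) t"
    by (simp only: primitive_add[OF L1] primitive_cmult coeff_L1_loc h u v)
  finally show ?thesis .
qed

text \<open>
  The parities of the two primitives make the terms with undifferentiated coefficients cancel: the one multiplying
  \<open>v\<close> is odd, so reflection changes its sign, which is compensated by the sign of \<open>a\<close> in the equation of \<open>v\<close>.
\<close>

lemma variation_of_parameters:
  assumes h: "h \<in> L1_loc"
    and u: "\<And>t. (u has_real_derivative (- a * u (- t) - b * u t)) (at t)" "u 0 = 1"
    and v: "\<And>t. (v has_real_derivative (a * v (- t) - b * v t)) (at t)" "v 0 = 1"
  defines "B \<equiv> \<lambda>t. u t * primitive (coeff_u v h) t + v t * primitive (coeff_v u h) t"
  shows "continuous_on UNIV B"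
    and "\<exists>B'. weak_derivative B B' \<and> (\<forall>t. B' t + a * B (- t) + b * B t = h t)"
proof -
  have uc: "continuous_on UNIV u" and vc: "continuous_on UNIV v"
    by (auto intro!: continuous_at_imp_continuous_on DERIV_isCont[OF u(1)] DERIV_isCont[OF v(1)])
  have u'c: "continuous_on UNIV (\<lambda>t. - a * u (- t) - b * u t)"
    and v'c: "continuous_on UNIV (\<lambda>t. a * v (- t) - b * v t)"
    by (intro continuous_intros uc vc continuous_reflect)+
  define \<Phi> where "\<Phi> = primitive (coeff_u v h)"
  define \<Psi> where "\<Psi> = primitive (coeff_v u h)"
  have L1: "coeff_u v h \<in> L1_loc" "coeff_v u h \<in> L1_loc"
    by (rule coeff_L1_loc h uc vc)+
  have incr: "\<Phi> y - \<Phi> x = integral {x..y} (coeff_u v h)" "\<Psi> y - \<Psi> x = integral {x..y} (coeff_v u h)"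
    if "x \<le> y" for x y
    unfolding \<Phi>_def \<Psi>_def by (rule primitive_diff L1 that)+
  have parity: "\<Phi> (- t) = \<Phi> t" "\<Psi> (- t) = - \<Psi> t" for t
    unfolding \<Phi>_def \<Psi>_def by (rule primitive_odd primitive_even L1 coeff_uminus)+
  have B: "B = (\<lambda>t. u t * \<Phi> t + v t * \<Psi> t)"
    by (simp add: B_def \<Phi>_def \<Psi>_def)
  show "continuous_on UNIV B"
    unfolding B
    by (intro continuous_intros uc vc continuous_if_increments_integral[OF L1(1) incr(1)]
        continuous_if_increments_integral[OF L1(2) incr(2)])
  define B' where "B' t = (- a * u (- t) - b * u t) * \<Phi> t + u t * coeff_u v h t
      + ((a * v (- t) - b * v t) * \<Psi> t + v t * coeff_v u h t)" for t
  have "weak_derivative B B'"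
    unfolding B B'_def[abs_def]
    by (intro weak_derivative_add weak_derivative_C1_mult[OF L1(1) incr(1) u(1) u'c]
        weak_derivative_C1_mult[OF L1(2) incr(2) v(1) v'c])
  moreover have "B' t + a * B (- t) + b * B t = h t" for t
  proof -
    have "B' t + a * B (- t) + b * B t = u t * coeff_u v h t + v t * coeff_v u h t"
      by (simp add: B'_def B parity algebra_simps)
    also have "\<dots> = h t * (even_part u t * even_part v t - odd_part u t * odd_part v t)"
      by (simp add: coeff_u_def coeff_v_def even_part_def odd_part_def field_simps)
    finally show ?thesis
      using parity_determinant_const[OF u(1) v(1)] u(2) v(2) by simp
  qed
  ultimately show "\<exists>B'. weak_derivative B B' \<and> (\<forall>t. B' t + a * B (- t) + b * B t = h t)"
    by blast
qed

text \<open>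
  The right-hand side \<open>- a z(- t) - b z(t)\<close> is continuous, so the weak solution is classical and
  \<open>reflection_ode_unique\<close> applies.
\<close>

lemma weak_reflection_ode_unique:
  assumes zc: "continuous_on UNIV z" and g: "weak_derivative z g"
    and eq: "AE t in lebesgue. g t + a * z (- t) + b * z t = 0"
    and u: "\<And>t. (u has_real_derivative (- a * u (- t) - b * u t)) (at t)" "u 0 = 1"
    and v: "\<And>t. (v has_real_derivative (a * v (- t) - b * v t)) (at t)" "v 0 = 1"
  shows "z t = z 0 * u t"
proof -
  define k where "k t = - a * z (- t) - b * z t" for t
  have kc: "continuous_on UNIV k"
    unfolding k_def[abs_def] by (intro continuous_intros zc continuous_reflect)
  have "z t = z 0 + primitive k t" for t
  proof -
    have gk: "AE t in lebesgue. g t = k t"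
      using eq by eventually_elim (simp add: k_def)
    have "g \<in> L1_loc"
      using g by (simp add: weak_derivative_def)
    then have "primitive g t = primitive k t"
      by (rule primitive_cong_AE[OF _ L1_loc_continuous[OF kc] gk])
    with weak_derivative_imp_primitive[OF zc g, of t] show ?thesis by simp
  qed
  then have z: "z = (\<lambda>t. z 0 + primitive k t)"
    by (rule ext)
  have "(z has_real_derivative - a * z (- t) - b * z t) (at t)" for t
  proof -
    have "((\<lambda>t. z 0 + primitive k t) has_real_derivative 0 + k t) (at t)"
      by (intro DERIV_add DERIV_const primitive_has_real_derivative[OF kc])
    then show ?thesis
      by (simp only: z[symmetric] k_def add_0)
  qed
  then show ?thesis
    using u v by (rule reflection_ode_unique)
qed

theorem corollary2p5:
  fixes a b c t\<^sub>0 :: real and h ut vt :: "real \<Rightarrow> real"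
  assumes "h \<in> L1_loc"
    and "\<forall>t. ut differentiable (at t)" and "\<forall>t. deriv ut t + a * ut (- t) + b * ut t = 0"
    and "ut 0 = 1"
    and "\<forall>t. vt differentiable (at t)" and "\<forall>t. deriv vt t - a * vt (- t) + b * vt t = 0"
    and "vt 0 = 1"
    and "ut t\<^sub>0 \<noteq> 0"
  shows "(\<exists>!u. reflection_solution a b h t\<^sub>0 c u) \<and>
    (\<forall>u. reflection_solution a b h t\<^sub>0 c u \<longrightarrow>
      (\<forall>t. u t = (\<integral>s. Green ut vt t s * h s \<partial>lebesgue)
                + (c - u_bar ut vt h t\<^sub>0) / ut t\<^sub>0 * ut t))"
proof -
  have deriv: "deriv ut t = - a * ut (- t) - b * ut t" "deriv vt t = a * vt (- t) - b * vt t" for t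
    using assms(3)[rule_format, of t] assms(6)[rule_format, of t] by simp_all
  have ut: "(ut has_real_derivative (- a * ut (- t) - b * ut t)) (at t)" for t
    using assms(2) deriv(1)[of t] by (metis DERIV_deriv_iff_real_differentiable)
  have vt: "(vt has_real_derivative (a * vt (- t) - b * vt t)) (at t)" for t
    using assms(5) deriv(2)[of t] by (metis DERIV_deriv_iff_real_differentiable)
  have utc: "continuous_on UNIV ut" and vtc: "continuous_on UNIV vt"
    by (auto intro!: continuous_at_imp_continuous_on DERIV_isCont[OF ut] DERIV_isCont[OF vt])
  have D: "even_part ut s * even_part vt s - odd_part ut s * odd_part vt s = 1" for s
    using parity_determinant_const[OF ut vt] assms(4,7) by simp
  define B where "B t = ut t * primitive (coeff_u vt h) t + vt t * primitive (coeff_v ut h) t" for t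
  have u_bar: "u_bar ut vt h t = B t" for t
    by (simp add: u_bar_def D B_def coeff_u_def[abs_def] coeff_v_def[abs_def])
  have Green: "(\<integral>s. Green ut vt t s * h s \<partial>lebesgue) = B t" for t
    unfolding B_def by (rule Green_integral[OF assms(1) utc vtc])
  define \<kappa> where "\<kappa> = (c - u_bar ut vt h t\<^sub>0) / ut t\<^sub>0"
  define U where "U t = B t + ut t * \<kappa>" for t
  have Uc: "continuous_on UNIV U" and U0: "U t\<^sub>0 = c"
    using variation_of_parameters(1)[OF assms(1) ut assms(4) vt assms(7)] assms(8)
    by (auto simp: U_def[abs_def] B_def[abs_def] \<kappa>_def u_bar intro!: continuous_intros utc)
  obtain U' where U': "weak_derivative U U'" "\<And>t. U' t + a * U (- t) + b * U t = h t"
  proof -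
    obtain B' where B': "weak_derivative B B'" "\<And>t. B' t + a * B (- t) + b * B t = h t"
      using variation_of_parameters(2)[OF assms(1) ut assms(4) vt assms(7)]
      unfolding B_def[abs_def] by blast
    have "weak_derivative (\<lambda>t. ut t * \<kappa>) (\<lambda>t. (- a * ut (- t) - b * ut t) * \<kappa> + ut t * 0)"
    proof (rule weak_derivative_C1_mult[OF _ _ ut])
      show "continuous_on UNIV (\<lambda>t. - a * ut (- t) - b * ut t)"
        by (intro continuous_intros utc continuous_reflect)
    qed (auto intro: L1_loc_continuous)
    from weak_derivative_add[OF B'(1) this] show ?thesis
    proof (rule that[unfolded U_def[abs_def]])
      fix t
      show "B' t + ((- a * ut (- t) - b * ut t) * \<kappa> + ut t * 0)
          + a * (B (- t) + ut (- t) * \<kappa>) + b * (B t + ut t * \<kappa>) = h t"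
        using B'(2)[of t] by (simp add: algebra_simps)
    qed
  qed
  have sol: "reflection_solution a b h t\<^sub>0 c U"
    using Uc U0 U' by (auto simp: reflection_solution_def W11_loc_def)
  moreover have unique: "w = U" if w: "reflection_solution a b h t\<^sub>0 c w" for w
  proof -
    obtain w' where w': "weak_derivative w w'" "AE t in lebesgue. w' t + a * w (- t) + b * w t = h t"
      and wc: "continuous_on UNIV w" "w t\<^sub>0 = c"
      using w by (auto simp: reflection_solution_def W11_loc_def)
    have hom: "AE t in lebesgue. (w' t - U' t) + a * (w (- t) - U (- t)) + b * (w t - U t) = 0"
      using w'(2)
    proof eventually_elim
      case (elim t)
      with U'(2)[of t] show ?case by (simp add: algebra_simps)
    qed
    have wU: "w t - U t = (w 0 - U 0) * ut t" for t
      by (rule weak_reflection_ode_unique[OF _ weak_derivative_diff[OF w'(1) U'(1)] hom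
            ut assms(4) vt assms(7)]) (intro continuous_intros wc Uc)
    from wU[of t\<^sub>0] have "w 0 - U 0 = 0"
      using assms(8) wc(2) U0 by simp
    with wU show ?thesis
      by (simp add: fun_eq_iff)
  qed
  moreover have "U t = (\<integral>s. Green ut vt t s * h s \<partial>lebesgue)
                + (c - u_bar ut vt h t\<^sub>0) / ut t\<^sub>0 * ut t" for t
    by (simp add: U_def Green \<kappa>_def)
  ultimately show ?thesis
    by blast
qed

end
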